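(* Arc crossing change I is an unknotting operation for all link diagrams; that is, for every connected link diagram $L$ there is a finite sequence of arc crossing changes I, applied successively starting from $L$, which transforms $L$ into a link diagram (with the same underlying 4-valent plane graph) representing an unlink.
   Context: Link diagrams are classical diagrams in the plane, with finitely many transverse double points equipped with over/under information, and are assumed connected, meaning that the underlying 4-valent plane graph (the shadow) is connected. An arc of a link diagram is a piece of a component running from one undercrossing point to the next undercrossing point along that component, with no undercrossing points in its interior (it may pass over crossings in between). Its two endpoints are undercrossing points; they may be at the same crossing, which happens when the component goes under at exactly one crossing. To switch a crossing means to exchange its over- and understrand. Arc crossing change I applied to an arc $a$: if the two endpoints of $a$ are at two distinct crossings, both of these crossings are switched; if the two endpoints of $a$ are at the same crossing, that crossing is switched. All other crossings are left unchanged. Each operation in a sequence is applied to an arc of the diagram obtained from the previous operations. The shadow is fixed throughout: no Reidemeister moves are performed. *)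

theory Defs
  imports "HOL-Analysis.Analysis"
begin

text \<open>
  The plane is the type of complex numbers and 3-space is the product of the plane with a
  real height coordinate.  Component \<open>i\<close> of a diagram is a closed curve with period 1; a point of
  the parametrising union of circles is a pair \<open>(i, t)\<close> with \<open>0 \<le> t < 1\<close>.  The over/under
  information is the set \<open>under\<close> of those parameters that run through the understrand of a crossing.
\<close>

record diagram =
  ncomps :: nat
  strand :: "nat \<Rightarrow> real \<Rightarrow> complex"
  under :: "(nat \<times> real) set"

definition params :: "diagram \<Rightarrow> (nat \<times> real) set" where
  "params D = {..<ncomps D} \<times> {0..<1}"

definition point :: "diagram \<Rightarrow> nat \<times> real \<Rightarrow> complex" where
  "point D p = strand D (fst p) (snd p)"

definition velocity :: "diagram \<Rightarrow> nat \<times> real \<Rightarrow> complex" where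
  "velocity D p = vector_derivative (strand D (fst p)) (at (snd p))"

definition fibre :: "diagram \<Rightarrow> complex \<Rightarrow> (nat \<times> real) set" where
  "fibre D x = {p \<in> params D. point D p = x}"

definition crossings :: "diagram \<Rightarrow> complex set" where
  "crossings D = {x. \<exists>p \<in> fibre D x. \<exists>q \<in> fibre D x. p \<noteq> q}"

definition shadow :: "diagram \<Rightarrow> complex set" where
  "shadow D = (\<Union>i<ncomps D. range (strand D i))"

text \<open>
  Regular closed \<open>C\<^sup>1\<close> curves whose only multiple points are finitely many transverse double points
  (the two tangent directions span the plane), each with exactly one understrand.
  Connectedness of the shadow is not included.
\<close>

definition link_diagram :: "diagram \<Rightarrow> bool" where
  "link_diagram D \<longleftrightarrow>
     ncomps D > 0 \<and>
     (\<forall>i<ncomps D. strand D i C1_differentiable_on UNIV \<and>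
        (\<forall>t. strand D i (t + 1) = strand D i t) \<and>
        (\<forall>t. vector_derivative (strand D i) (at t) \<noteq> 0)) \<and>
     finite (crossings D) \<and>
     (\<forall>x\<in>crossings D. card (fibre D x) = 2) \<and>
     (\<forall>p\<in>params D. \<forall>q\<in>params D. p \<noteq> q \<and> point D p = point D q \<longrightarrow>
        span {velocity D p, velocity D q} = UNIV) \<and>
     under D \<subseteq> (\<Union>x\<in>crossings D. fibre D x) \<and>
     (\<forall>x\<in>crossings D. \<exists>!p. p \<in> under D \<inter> fibre D x)"

definition switch :: "complex set \<Rightarrow> diagram \<Rightarrow> diagram" where
  "switch C D = D\<lparr>under := {p \<in> (\<Union>x\<in>crossings D. fibre D x).
     if point D p \<in> C then p \<notin> under D else p \<in> under D}\<rparr>"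

text \<open>
  The arc of component \<open>i\<close> traced out by the parameters from \<open>s\<close> to \<open>t\<close>, read modulo the period 1.
  If the component has a single undercrossing point, then \<open>t = s + 1\<close>.
\<close>

definition is_arc :: "diagram \<Rightarrow> nat \<Rightarrow> real \<Rightarrow> real \<Rightarrow> bool" where
  "is_arc D i s t \<longleftrightarrow> i < ncomps D \<and> s < t \<and>
     (i, frac s) \<in> under D \<and> (i, frac t) \<in> under D \<and>
     (\<forall>u\<in>{s<..<t}. (i, frac u) \<notin> under D)"

text \<open>
  The crossings to be switched form a set, so when both endpoints lie at the same crossing that
  crossing is switched once.
\<close>

definition arc_change_I :: "diagram \<Rightarrow> diagram \<Rightarrow> bool" where
  "arc_change_I D D' \<longleftrightarrow>
     (\<exists>i s t. is_arc D i s t \<and> D' = switch {strand D i s, strand D i t} D)"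

text \<open>Ambient isotopy of subsets of 3-space: a homotopy from the identity through homeomorphisms.\<close>

definition ambient_isotopic :: "(complex \<times> real) set \<Rightarrow> (complex \<times> real) set \<Rightarrow> bool" where
  "ambient_isotopic K K' \<longleftrightarrow>
     (\<exists>\<phi>. homotopic_with_canon (\<lambda>f. \<exists>g. homeomorphism UNIV UNIV f g) UNIV UNIV id \<phi> \<and> \<phi> ` K = K')"

definition standard_unlink :: "nat \<Rightarrow> (complex \<times> real) set" where
  "standard_unlink m = (\<Union>k<m. sphere (of_real (3 * real k)) 1 \<times> {0})"

definition unlink :: "(complex \<times> real) set \<Rightarrow> bool" where
  "unlink K \<longleftrightarrow> (\<exists>m. ambient_isotopic K (standard_unlink m))"

text \<open>
  \<open>K\<close> projects onto the shadow of \<open>D\<close>, with heights that agree with the over/under information.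
  Any two links represented by \<open>D\<close> are isotopic (interpolate the heights linearly), so it does not
  matter which of them is taken in \<open>represents_unlink\<close>.
\<close>

definition represents :: "diagram \<Rightarrow> (complex \<times> real) set \<Rightarrow> bool" where
  "represents D K \<longleftrightarrow>
     (\<exists>h :: nat \<Rightarrow> real \<Rightarrow> real.
        (\<forall>i<ncomps D. continuous_on UNIV (h i) \<and> (\<forall>t. h i (t + 1) = h i t)) \<and>
        (\<forall>x\<in>crossings D. \<forall>(i, s)\<in>fibre D x \<inter> under D. \<forall>(j, t)\<in>fibre D x - under D. h i s < h j t) \<and>
        K = (\<Union>i<ncomps D. range (\<lambda>t. (strand D i t, h i t))))"

definition represents_unlink :: "diagram \<Rightarrow> bool" where
  "represents_unlink D \<longleftrightarrow> (\<exists>K. represents D K \<and> unlink K)"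

end

theory Submission imports Defs begin

text \<open>
  Treat the components one after the other.  Changing an arc of a component affects only its
  self-crossings and the crossings where it passes under another component, and a crossing of the
  latter kind ends up with the component on top.  So every component can be lifted above all earlier
  ones, after which its arc changes switch pairs of self-crossings.  Moving the base point past one
  self-crossing changes the parity of the number of self-crossings that have to be switched in order
  to make the component descending, so this number may be assumed even, and then arc changes suffice.

  The resulting diagram is realised by a link whose components lie in disjoint slabs of heights and
  meet every level strictly between their top and bottom in exactly two points.  A continuous family
  of complex similarities of the levels turns each component into a round vertical circle.  Each
  similarity is \<open>z \<mapsto> exp (c y) z + d y\<close>, so scaling \<open>c\<close> and \<open>d\<close> gives the ambient isotopy.
\<close>

section \<open>Arc changes on the parameter circles\<close>

lemma frac_frac_add_diff:
  assumes "0 \<le> u" "u < 1"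
  shows "frac (frac (b + u) - b) = u"
proof -
  have "frac (b + u) - b - u \<in> \<int>" by (simp add: frac_def)
  then show ?thesis using assms by (simp add: frac_unique_iff)
qed

lemma frac_add_frac_diff: "frac (b + frac (t - b)) = frac t"
proof -
  have "b + frac (t - b) - frac t \<in> \<int>" by (simp add: frac_def)
  then show ?thesis by (simp add: frac_unique_iff frac_lt_1)
qed

text \<open>The combinatorial core of a diagram: \<open>P\<close> stands for the parameters that run
  through crossings, and \<open>\<sigma>\<close> exchanges the two parameters of one crossing. Arc
  changes depend only on cyclic positions, so the plane curve is forgotten here.\<close>

locale crossing_game =
  fixes P :: "(nat \<times> real) set" and \<sigma> :: "nat \<times> real \<Rightarrow> nat \<times> real"
  assumes finite_P: "finite P"
    and snd_P: "p \<in> P \<Longrightarrow> snd p \<in> {0..<1}"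
    and partner_in: "p \<in> P \<Longrightarrow> \<sigma> p \<in> P"
    and partner_neq: "p \<in> P \<Longrightarrow> \<sigma> p \<noteq> p"
    and partner_partner: "p \<in> P \<Longrightarrow> \<sigma> (\<sigma> p) = p"
begin

definition state :: "(nat \<times> real) set \<Rightarrow> bool" where
  "state U \<longleftrightarrow> U \<subseteq> P \<and> (\<forall>p\<in>P. \<sigma> p \<in> U \<longleftrightarrow> p \<notin> U)"

text \<open>Membership in one set, rather than two successive switches, makes a crossing that
  carries both endpoints switch once.\<close>

definition flip :: "nat \<times> real \<Rightarrow> nat \<times> real \<Rightarrow> (nat \<times> real) set \<Rightarrow> (nat \<times> real) set" where
  "flip p q U = {x \<in> P. if x \<in> {p, \<sigma> p, q, \<sigma> q} then x \<notin> U else x \<in> U}"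

definition arc :: "(nat \<times> real) set \<Rightarrow> nat \<Rightarrow> real \<Rightarrow> real \<Rightarrow> bool" where
  "arc U k s t \<longleftrightarrow> s < t \<and> (k, frac s) \<in> U \<and> (k, frac t) \<in> U \<and> (\<forall>u\<in>{s<..<t}. (k, frac u) \<notin> U)"

definition move :: "nat \<Rightarrow> (nat \<times> real) set \<Rightarrow> (nat \<times> real) set \<Rightarrow> bool" where
  "move k U U' \<longleftrightarrow> (\<exists>s t. arc U k s t \<and> U' = flip (k, frac s) (k, frac t) U)"

definition pos :: "real \<Rightarrow> nat \<times> real \<Rightarrow> real" where
  "pos b p = frac (snd p - b)"

text \<open>The obstructions to component \<open>k\<close> descending from \<open>b\<close>. Each
  such crossing is represented by its understrand parameter only, so the cardinality counts
  crossings.\<close>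

definition bad :: "nat \<Rightarrow> real \<Rightarrow> (nat \<times> real) set \<Rightarrow> (nat \<times> real) set" where
  "bad k b U = {p \<in> U. fst p = k \<and> fst (\<sigma> p) = k \<and> pos b p < pos b (\<sigma> p)}"

definition mixed :: "nat \<Rightarrow> (nat \<times> real) set \<Rightarrow> (nat \<times> real) set" where
  "mixed k U = {p \<in> U. fst p = k \<and> fst (\<sigma> p) \<noteq> k}"

lemma state_flip:
  assumes "state U" "p \<in> P" "q \<in> P"
  shows "state (flip p q U)"
proof -
  have "\<sigma> x \<in> {p, \<sigma> p, q, \<sigma> q} \<longleftrightarrow> x \<in> {p, \<sigma> p, q, \<sigma> q}" if "x \<in> P" for x
    using that assms partner_partner by (metis insertE insertI1 insertI2 singletonD)
  then show ?thesis
    using assms partner_in unfolding state_def flip_def by auto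
qed

lemma moveE:
  assumes "state U" "move k U U'"
  obtains p q where "p \<in> P" "q \<in> P" "fst p = k" "fst q = k" "U' = flip p q U"
proof -
  obtain s t where st: "arc U k s t" "U' = flip (k, frac s) (k, frac t) U"
    using assms(2) unfolding move_def by blast
  then have "(k, frac s) \<in> P" "(k, frac t) \<in> P" using assms(1) by (auto simp: arc_def state_def)
  with st(2) show thesis by (intro that[of "(k, frac s)" "(k, frac t)"]) auto
qed

lemma state_move: "state U \<Longrightarrow> move k U U' \<Longrightarrow> state U'"
  by (metis moveE state_flip)

text \<open>Both endpoints of the arc lie on \<open>k\<close>, so every switched crossing has a
  strand on \<open>k\<close>. This protects the order among earlier components while a later one is
  treated.\<close>

lemma move_frame:
  assumes "state U" "move k U U'" "x \<in> P" "fst x \<noteq> k" "fst (\<sigma> x) \<noteq> k"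
  shows "x \<in> U' \<longleftrightarrow> x \<in> U"
proof -
  obtain p q where "p \<in> P" "q \<in> P" "fst p = k" "fst q = k" "U' = flip p q U"
    using moveE[OF assms(1,2)] .
  moreover from this have "x \<notin> {p, \<sigma> p, q, \<sigma> q}"
    using assms partner_partner[of p] partner_partner[of q] by auto
  ultimately show ?thesis
    using assms unfolding flip_def by auto
qed

lemma state_moves: "(move k)\<^sup>*\<^sup>* U U' \<Longrightarrow> state U \<Longrightarrow> state U'"
  by (induction rule: rtranclp_induct) (auto intro: state_move)

lemma moves_frame:
  assumes "(move k)\<^sup>*\<^sup>* U U'" "state U" "x \<in> P" "fst x \<noteq> k" "fst (\<sigma> x) \<noteq> k"
  shows "x \<in> U' \<longleftrightarrow> x \<in> U"
  using assms(1)
proof (induction rule: rtranclp_induct)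
  case (step V W)
  then show ?case using move_frame[OF state_moves[OF step(1) assms(2)] step(2)] assms by blast
qed simp

lemma frac_id: "p \<in> P \<Longrightarrow> frac (snd p) = snd p"
  using snd_P by (simp add: frac_eq)

lemma pos_bounds: "0 \<le> pos b p" "pos b p < 1"
  by (auto simp: pos_def frac_lt_1)

lemma frac_base_pos: "p \<in> P \<Longrightarrow> frac (b + pos b p) = snd p"
  using frac_add_frac_diff[of b "snd p"] frac_id by (simp add: pos_def)

lemma pos_frac:
  assumes "b \<le> u" "u < b + 1"
  shows "pos b (k, frac u) = u - b"
  using frac_frac_add_diff[of "u - b" b] assms by (simp add: pos_def)

lemma pos_inj:
  assumes "p \<in> P" "q \<in> P" "fst p = fst q" "pos b p = pos b q"
  shows "p = q"
  using assms frac_base_pos[of p b] frac_base_pos[of q b] by (simp add: prod_eq_iff)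

text \<open>Lifting both positions to the period that starts at \<open>b\<close> gives a real
  interval on which \<open>pos b\<close> is a translation, so the gap condition says that no
  undercrossing lies inside it.\<close>

lemma move_adjacent:
  assumes "state U" "p \<in> U" "q \<in> U" "fst p = k" "fst q = k" "pos b p < pos b q"
    and gap: "\<And>x. x \<in> U \<Longrightarrow> fst x = k \<Longrightarrow> pos b p < pos b x \<Longrightarrow> pos b q \<le> pos b x"
  shows "move k U (flip p q U)"
proof -
  have P: "p \<in> P" "q \<in> P" using assms unfolding state_def by auto
  have eq: "(k, frac (b + pos b p)) = p" "(k, frac (b + pos b q)) = q"
    using frac_base_pos P assms by (auto simp: prod_eq_iff)
  have "(k, frac u) \<notin> U" if "u \<in> {b + pos b p<..<b + pos b q}" for u
  proof
    assume "(k, frac u) \<in> U"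
    moreover have "pos b (k, frac u) = u - b"
      using that pos_bounds[of b p] pos_bounds[of b q] by (intro pos_frac) auto
    ultimately show False using gap[of "(k, frac u)"] that by auto
  qed
  then have "arc U k (b + pos b p) (b + pos b q)"
    unfolding arc_def eq using assms by auto
  then show ?thesis unfolding move_def using eq by metis
qed

text \<open>Running on from \<open>p\<close>, an undercrossing is met within one full period, at the
  latest \<open>p\<close> itself. The case \<open>q = p\<close> is a component with a single
  undercrossing.\<close>

lemma ex_next_under:
  assumes "state U" "p \<in> U" "fst p = k"
  obtains q where "q \<in> U" "fst q = k" "move k U (flip p q U)"
proof -
  have fin: "finite U" using assms finite_P finite_subset unfolding state_def by blast
  have pP: "p \<in> P" using assms unfolding state_def by auto
  define s where "s = snd p"
  have p: "p = (k, frac s)" using assms frac_id[OF pP] by (auto simp: s_def prod_eq_iff)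
  \<comment> \<open>The half-open range of length one makes \<open>frac\<close> injective on
    \<open>T\<close>; it includes \<open>s + 1\<close>, the return to \<open>p\<close>, so
    \<open>T\<close> is nonempty.\<close>
  define T where "T = {u. s < u \<and> u \<le> s + 1 \<and> (k, frac u) \<in> U}"
  have inj: "inj_on (\<lambda>u. (k, frac u)) T"
  proof (rule inj_onI)
    fix u v assume uv: "u \<in> T" "v \<in> T" "(k, frac u) = (k, frac v)"
    then have "u - v \<in> \<int>" by (simp add: frac_def) (metis Ints_of_int add_diff_cancel diff_add_cancel of_int_diff diff_diff_eq2 add.commute)
    moreover have "\<bar>u - v\<bar> < 1" using uv unfolding T_def by auto
    ultimately show "u = v" using Ints_nonzero_abs_less1 by fastforce
  qed
  have "finite T" by (rule inj_on_finite[OF inj _ fin]) (auto simp: T_def)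
  have "s + 1 \<in> T" using assms p by (auto simp: T_def frac_1_eq)
  then have Tne: "T \<noteq> {}" by auto
  define t where "t = Min T"
  have tT: "t \<in> T" using Min_in[OF \<open>finite T\<close> Tne] t_def by simp
  have min: "\<And>u. u \<in> T \<Longrightarrow> t \<le> u" using \<open>finite T\<close> t_def by simp
  have "arc U k s t"
    using tT assms p min unfolding arc_def T_def by fastforce
  then have "move k U (flip p (k, frac t) U)" unfolding move_def p by blast
  then show thesis using tT that[of "(k, frac t)"] by (auto simp: T_def)
qed

text \<open>Induction on the number of crossings where \<open>k\<close> passes under another
  component. Changing an arc that starts at one of them moves its understrand off \<open>k\<close>,
  and switching the other endpoint cannot create a new one, since \<open>k\<close> was below
  there.\<close>

lemma clear_mixed:
  assumes "state U"
  shows "\<exists>U'. (move k)\<^sup>*\<^sup>* U U' \<and> mixed k U' = {}"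
  using assms
proof (induction "card (mixed k U)" arbitrary: U rule: less_induct)
  case less
  show ?case
  proof (cases "mixed k U = {}")
    case False
    then obtain p where p: "p \<in> mixed k U" by auto
    then obtain q where q: "q \<in> U" "fst q = k" and m: "move k U (flip p q U)"
      using ex_next_under[OF less(2), of p k] unfolding mixed_def by auto
    have UP: "U \<subseteq> P" using less(2) unfolding state_def by auto
    have "x \<in> mixed k U - {p}" if x: "x \<in> mixed k (flip p q U)" for x
    proof -
      have xP: "x \<in> P" "fst x = k" "fst (\<sigma> x) \<noteq> k" using x by (auto simp: mixed_def flip_def)
      \<comment> \<open>A flipped parameter that is now under must be \<open>\<sigma> p\<close> or
        \<open>\<sigma> q\<close>; its partner lies on \<open>k\<close>, so it is not mixed.\<close>
      have "x \<notin> {p, \<sigma> p, q, \<sigma> q}"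
      proof
        assume a: "x \<in> {p, \<sigma> p, q, \<sigma> q}"
        then have "x \<notin> U" using x by (simp add: mixed_def flip_def)
        then have "x = \<sigma> p \<or> x = \<sigma> q" using a p q(1) by (auto simp: mixed_def)
        then show False using xP p q UP partner_partner[of p] partner_partner[of q] by (auto simp: mixed_def)
      qed
      then show ?thesis using x xP by (auto simp: mixed_def flip_def)
    qed
    then have "mixed k (flip p q U) \<subset> mixed k U" using p by blast
    moreover have "finite (mixed k U)"
      using finite_subset[OF UP finite_P] by (simp add: mixed_def)
    ultimately have "card (mixed k (flip p q U)) < card (mixed k U)"
      by (simp add: psubset_card_mono)
    then show ?thesis
      using less(1)[OF _ state_move[OF less(2) m]] converse_rtranclp_into_rtranclp[of "move k", OF m]
      by blast
  qed auto
qed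

section \<open>Making the self-crossings of one component descending\<close>

lemma finite_bad: "state U \<Longrightarrow> finite (bad k b U)"
  using finite_subset[OF _ finite_P, of U] by (simp add: bad_def state_def)

text \<open>The undercrossing next to \<open>p\<close> on the side of \<open>q\<close> bounds an arc
  with \<open>p\<close>. It is no later than the later of \<open>p\<close> and \<open>q\<close>, so
  this arc stays before time \<open>m\<close>.\<close>

lemma adjacent_under:
  assumes st: "state U" and p: "p \<in> U" "fst p = k" and q: "q \<in> U" "fst q = k" "q \<noteq> p"
    and m: "pos b p < m" "pos b q < m"
  obtains t where "t \<in> U" "fst t = k" "t \<noteq> p" "pos b t < m" "move k U (flip p t U)"
proof -
  have fin: "finite U" using st finite_P finite_subset unfolding state_def by blast
  have UP: "U \<subseteq> P" using st unfolding state_def by auto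
  have ne: "pos b p \<noteq> pos b q" using pos_inj[of p q b] p q UP by auto
  show thesis
  proof (cases "pos b p < pos b q")
    case True
    define A where "A = {x \<in> U. fst x = k \<and> pos b p < pos b x}"
    have "finite A" "q \<in> A" using fin q True by (auto simp: A_def)
    then obtain t where t: "t \<in> A" "\<And>x. x \<in> A \<Longrightarrow> pos b t \<le> pos b x"
      using arg_min_if_finite[of A "pos b"] by (metis empty_iff linorder_not_less)
    have "move k U (flip p t U)"
      using t p by (intro move_adjacent[of U p t k b] st) (auto simp: A_def)
    moreover have "pos b t < m" using t(2)[OF \<open>q \<in> A\<close>] m by auto
    ultimately show thesis using that[of t] t by (auto simp: A_def)
  next
    case False
    define A where "A = {x \<in> U. fst x = k \<and> pos b x < pos b p}"
    have "finite A" "q \<in> A" using fin q False ne by (auto simp: A_def)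
    then have fA: "finite ((\<lambda>x. - pos b x) ` A)" "A \<noteq> {}" by auto
    obtain t where t: "t \<in> A" "\<And>x. x \<in> A \<Longrightarrow> pos b x \<le> pos b t"
      using arg_min_if_finite[of A "\<lambda>x. - pos b x"] \<open>finite A\<close> fA by (metis neg_le_iff_le linorder_not_less)
    have "move k U (flip t p U)"
      using t p by (intro move_adjacent[of U t p k b] st) (force simp: A_def)+
    moreover have "flip t p U = flip p t U" unfolding flip_def by auto
    moreover have "pos b t < m" using t m by (auto simp: A_def)
    ultimately show thesis using that[of t] t by (auto simp: A_def)
  qed
qed

text \<open>
  Among the bad crossings take the one visited last; since there are at least two of them, an
  arc at its understrand ends before that visit, and changing that arc creates no bad crossing
  that is visited as late.
\<close>

lemma clear_bad:
  assumes "state U" "mixed k U = {}" "even (card (bad k b U))"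
  shows "\<exists>U'. (move k)\<^sup>*\<^sup>* U U' \<and> mixed k U' = {} \<and> bad k b U' = {}"
  using assms
\<comment> \<open>The measure counts the parameters on \<open>k\<close> met up to the last second
  visit of a bad crossing: a natural-number rank for that time.\<close>
proof (induction "card {x \<in> P. \<exists>p\<in>bad k b U. fst x = k \<and> pos b x \<le> pos b (\<sigma> p)}" arbitrary: U rule: less_induct)
  case less
  note st = less(2)
  have UP: "U \<subseteq> P" and sw: "\<And>p. p \<in> P \<Longrightarrow> \<sigma> p \<in> U \<longleftrightarrow> p \<notin> U"
    using st unfolding state_def by auto
  have fin: "finite (bad k b U)" using finite_bad[OF st] .
  show ?case
  proof (cases "bad k b U = {}")
    case False
    then obtain p where p: "p \<in> bad k b U" and pmax: "\<And>x. x \<in> bad k b U \<Longrightarrow> pos b (\<sigma> x) \<le> pos b (\<sigma> p)"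
      using arg_min_if_finite[of "bad k b U" "\<lambda>x. - pos b (\<sigma> x)"] fin by (metis neg_le_iff_le linorder_not_less)
    \<comment> \<open>Evenness excludes a single bad crossing.\<close>
    have "bad k b U \<noteq> {p}" using less(4) by auto
    then obtain q where q: "q \<in> bad k b U" "q \<noteq> p" using p by auto
    have qp: "pos b q < pos b (\<sigma> p)" using pmax[OF q(1)] q(1) by (auto simp: bad_def)
    obtain t where t: "t \<in> U" "fst t = k" "t \<noteq> p" "pos b t < pos b (\<sigma> p)" and m: "move k U (flip p t U)"
      using adjacent_under[OF st, of p k q b "pos b (\<sigma> p)"] p q qp by (auto simp: bad_def)
    define V where "V = flip p t U"
    have pU: "p \<in> P" "p \<in> U" "t \<in> P" "fst p = k" "fst (\<sigma> p) = k" "pos b p < pos b (\<sigma> p)"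
      using p UP t by (auto simp: bad_def)
    have st_k: "fst (\<sigma> t) = k" using less(3) t(1,2) unfolding mixed_def by blast
    have dist: "\<sigma> p \<notin> U" "\<sigma> t \<notin> U" "\<sigma> p \<noteq> \<sigma> t" using sw pU t partner_partner by metis+
    have V: "V = U - {p, t} \<union> {\<sigma> p, \<sigma> t}"
      using UP pU t dist partner_in unfolding V_def flip_def by auto
    have mixed: "mixed k V = {}"
      using less(3) pU(1,3-5) t(2) st_k partner_partner[of p] partner_partner[of t]
      unfolding mixed_def V by fastforce
    have tne: "pos b (\<sigma> t) \<noteq> pos b t" using pos_inj partner_neq partner_in pU t st_k by metis
    \<comment> \<open>Switching makes the crossing of \<open>p\<close> good and toggles that of
      \<open>t\<close>, so the number of bad crossings falls by two or stays the same, and its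
      parity survives.\<close>
    have badV: "bad k b V = (if t \<in> bad k b U then bad k b U - {p, t} else insert (\<sigma> t) (bad k b U - {p}))"
    proof -
      define Q where "Q x \<longleftrightarrow> fst x = k \<and> fst (\<sigma> x) = k \<and> pos b x < pos b (\<sigma> x)" for x
      have bad: "bad k b W = {x \<in> W. Q x}" for W by (auto simp: bad_def Q_def)
      have "Q p" "\<not> Q (\<sigma> p)" "Q (\<sigma> t) \<longleftrightarrow> \<not> Q t"
        using pU t(2) st_k partner_partner[of p] partner_partner[of t] tne by (auto simp: Q_def)
      then show ?thesis using t(1,3) pU(2) dist(2) unfolding bad V
        by (cases "Q t"; simp; intro set_eqI; simp; metis)
    qed
    have "even (card (bad k b V))"
    proof (cases "t \<in> bad k b U")
      case True
      then have "card (bad k b V) = card (bad k b U) - 2"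
        using badV card_Diff_subset[of "{p, t}" "bad k b U"] p t(3) by simp
      then show ?thesis using less(4) by simp
    next
      case False
      then have "card (bad k b V) = card (bad k b U)"
        using badV card.remove[OF fin p] fin dist(2) by (auto simp: bad_def card_insert_if)
      then show ?thesis using less(4) by auto
    qed
    moreover have "card {x \<in> P. \<exists>p\<in>bad k b V. fst x = k \<and> pos b x \<le> pos b (\<sigma> p)}
        < card {x \<in> P. \<exists>p\<in>bad k b U. fst x = k \<and> pos b x \<le> pos b (\<sigma> p)}" (is "card ?A < card ?B")
    proof (rule psubset_card_mono)
      have less: "pos b (\<sigma> x) < pos b (\<sigma> p)" if x: "x \<in> bad k b V" for x
      proof (cases "x = \<sigma> t")
        case True then show ?thesis using t partner_partner pU by auto
      next
        case False
        then have xU: "x \<in> bad k b U" "x \<noteq> p" using x badV by (auto split: if_splits)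
        then have "x \<in> P" "fst (\<sigma> x) = k" using UP by (auto simp: bad_def)
        moreover have "\<sigma> x \<noteq> \<sigma> p" using xU(2) partner_partner \<open>x \<in> P\<close> pU(1) by metis
        ultimately have "pos b (\<sigma> x) \<noteq> pos b (\<sigma> p)"
          using pos_inj[of "\<sigma> x" "\<sigma> p" b] partner_in pU by auto
        then show ?thesis using pmax[OF xU(1)] by auto
      qed
      have "\<sigma> p \<in> ?B" using p pU partner_in by auto
      moreover have "\<sigma> p \<notin> ?A" using less by force
      moreover have "?A \<subseteq> ?B"
      proof
        fix x assume "x \<in> ?A"
        then obtain y where y: "x \<in> P" "fst x = k" "y \<in> bad k b V" "pos b x \<le> pos b (\<sigma> y)" by blast
        then have "pos b x \<le> pos b (\<sigma> p)" using less[of y] by linarith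
        then show "x \<in> ?B" using y p by blast
      qed
      ultimately show "?A \<subset> ?B" by blast
    qed (use finite_P in auto)
    ultimately obtain U' where "(move k)\<^sup>*\<^sup>* V U'" "mixed k U' = {}" "bad k b U' = {}"
      using less(1)[of V] state_move[OF st m] mixed V_def by blast
    then show ?thesis using converse_rtranclp_into_rtranclp[of "move k", OF m] V_def by blast
  qed (use less in auto)
qed

text \<open>
  Moving the base point past one parameter of a self-crossing exchanges the two visits of that
  crossing and keeps the order of the visits of all other crossings.
\<close>

lemma ex_even_base:
  assumes st: "state U"
  shows "\<exists>b. even (card (bad k b U))"
proof (rule ccontr)
  assume no: "\<not> ?thesis"
  have UP: "U \<subseteq> P" and sw: "\<And>p. p \<in> P \<Longrightarrow> \<sigma> p \<in> U \<longleftrightarrow> p \<notin> U"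
    using st unfolding state_def by auto
  define S where "S = {p \<in> P. fst p = k \<and> fst (\<sigma> p) = k}"
  have finS: "finite S" using finite_P by (simp add: S_def)
  have SS: "\<sigma> p \<in> S" if "p \<in> S" for p using that partner_in partner_partner by (auto simp: S_def)
  have "bad k 0 U \<noteq> {}" using no by (metis card.empty even_zero)
  then have "S \<noteq> {}" using UP by (auto simp: S_def bad_def)
  then obtain x where x: "x \<in> S" and xmin: "\<And>y. y \<in> S \<Longrightarrow> snd x \<le> snd y"
    using arg_min_if_finite[of S snd] finS by (metis linorder_not_less)
  have "\<sigma> x \<in> S - {x}" using SS x partner_neq by (auto simp: S_def)
  then obtain z where z: "z \<in> S - {x}" and zmin: "\<And>y. y \<in> S - {x} \<Longrightarrow> snd z \<le> snd y"
    using arg_min_if_finite[of "S - {x}" snd] finS by (metis finite_Diff empty_iff linorder_not_less)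
  \<comment> \<open>\<open>x\<close> and \<open>z\<close> are the two earliest self-crossing
    parameters on \<open>k\<close>. Starting at \<open>z\<close> makes \<open>x\<close> the last one
    met.\<close>
  define b where "b = snd z"
  have Sr: "0 \<le> snd y" "snd y < 1" if "y \<in> S" for y using snd_P that by (auto simp: S_def)
  have xz: "snd x < snd z"
  proof -
    have "snd x \<noteq> snd z" using x z by (auto simp: S_def prod_eq_iff)
    moreover have "snd x \<le> snd z" using xmin z by blast
    ultimately show ?thesis by simp
  qed
  have pos0: "pos 0 y = snd y" if "y \<in> S" for y using Sr[OF that] by (simp add: pos_def frac_eq)
  have posb: "pos b y = snd y - b" if "y \<in> S" "y \<noteq> x" for y
    using Sr[OF that(1)] zmin[of y] that Sr[of z] z by (simp add: pos_def frac_eq b_def)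
  have posx: "pos b x = snd x - b + 1"
    using Sr[OF x] xz Sr[of z] z by (auto simp: pos_def b_def frac_unique_iff)
  have bad: "bad k c U = {p \<in> S \<inter> U. pos c p < pos c (\<sigma> p)}" for c
    using UP by (auto simp: bad_def S_def)
  \<comment> \<open>The common part of the two bad sets: only the crossing of \<open>x\<close> is
    treated differently from base points \<open>0\<close> and \<open>b\<close>.\<close>
  define E where "E = {p \<in> S \<inter> U - {x, \<sigma> x}. snd p < snd (\<sigma> p)}"
  have finE: "finite E" using finS by (simp add: E_def)
  have E0: "bad k 0 U - {x, \<sigma> x} = E"
  proof -
    have "pos 0 p < pos 0 (\<sigma> p) \<longleftrightarrow> snd p < snd (\<sigma> p)" if "p \<in> S" for p
      using pos0 SS that by simp
    then show ?thesis unfolding bad E_def by blast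
  qed
  have Eb: "bad k b U - {x, \<sigma> x} = E"
  proof -
    have "\<sigma> p \<noteq> x" if "p \<in> S" "p \<noteq> \<sigma> x" for p
      using that partner_partner[of p] by (auto simp: S_def)
    then have "pos b p < pos b (\<sigma> p) \<longleftrightarrow> snd p < snd (\<sigma> p)" if "p \<in> S" "p \<noteq> x" "p \<noteq> \<sigma> x" for p
      using posb SS that by simp
    then show ?thesis unfolding bad E_def by blast
  qed
  \<comment> \<open>From base \<open>0\<close> the first visit of this crossing is \<open>x\<close>,
    from base \<open>b\<close> it is \<open>\<sigma> x\<close>. Exactly one of them is an
    understrand, so the two counts are \<open>card E\<close> and \<open>card E + 1\<close> in some
    order.\<close>
  have x0: "x \<in> bad k 0 U \<longleftrightarrow> x \<in> U" "\<sigma> x \<notin> bad k 0 U"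
  proof -
    have "snd x < snd (\<sigma> x)" using zmin[of "\<sigma> x"] xz \<open>\<sigma> x \<in> S - {x}\<close> by force
    then show "x \<in> bad k 0 U \<longleftrightarrow> x \<in> U" "\<sigma> x \<notin> bad k 0 U"
      using x SS pos0 partner_partner by (auto simp: bad S_def)
  qed
  have xb: "x \<notin> bad k b U" "\<sigma> x \<in> bad k b U \<longleftrightarrow> x \<notin> U"
  proof -
    have "snd (\<sigma> x) < 1" "pos b (\<sigma> x) = snd (\<sigma> x) - b"
      using Sr posb \<open>\<sigma> x \<in> S - {x}\<close> by auto
    then have "pos b (\<sigma> x) < pos b x" using posx Sr[OF x] by auto
    then show "x \<notin> bad k b U" "\<sigma> x \<in> bad k b U \<longleftrightarrow> x \<notin> U"
      using x SS sw[of x] partner_partner[of x] by (auto simp: bad S_def)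
  qed
  have nE: "x \<notin> E" "\<sigma> x \<notin> E" by (auto simp: E_def)
  have "bad k 0 U = (if x \<in> U then insert x E else E)" using E0 x0 by auto
  moreover have "bad k b U = (if x \<in> U then E else insert (\<sigma> x) E)" using Eb xb by auto
  ultimately have "even (card (bad k 0 U)) \<or> even (card (bad k b U))"
    using finE nE by (cases "x \<in> U") auto
  then show False using no by blast
qed

text \<open>A stack of descending components, restricted to the first \<open>n\<close>: higher
  indices lie higher, and component \<open>i\<close> descends from base point
  \<open>b i\<close>.\<close>

definition layered :: "(nat \<Rightarrow> real) \<Rightarrow> nat \<Rightarrow> (nat \<times> real) set \<Rightarrow> bool" where
  "layered b n U \<longleftrightarrow> (\<forall>p\<in>U. fst p < n \<longrightarrow> fst (\<sigma> p) < n \<longrightarrow>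
     fst p < fst (\<sigma> p) \<or> fst p = fst (\<sigma> p) \<and> pos (b (fst p)) (\<sigma> p) < pos (b (fst p)) p)"

text \<open>Components are treated in increasing order. Clearing the mixed undercrossings of
  component \<open>n\<close> puts it above all others, and later rounds touch only crossings that
  involve later components.\<close>

lemma ex_layered:
  assumes "state U"
  shows "\<exists>U' b. (\<lambda>V W. \<exists>k. move k V W)\<^sup>*\<^sup>* U U' \<and> state U' \<and> layered b n U'"
proof (induction n)
  case 0
  show ?case using assms by (auto simp: layered_def)
next
  case (Suc n)
  then obtain V b where V: "(\<lambda>V W. \<exists>k. move k V W)\<^sup>*\<^sup>* U V" "state V" "layered b n V" by blast
  obtain W where W: "(move n)\<^sup>*\<^sup>* V W" "mixed n W = {}" using clear_mixed[OF V(2)] by blast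
  have stW: "state W" using state_moves W V by blast
  \<comment> \<open>The base point is chosen only now, because clearing mixed crossings may also
    have switched self-crossings.\<close>
  obtain c where c: "even (card (bad n c W))" using ex_even_base[OF stW] by blast
  obtain X where X: "(move n)\<^sup>*\<^sup>* W X" "mixed n X = {}" "bad n c X = {}"
    using clear_bad[OF stW W(2) c] by blast
  have VX: "(move n)\<^sup>*\<^sup>* V X" using W X by auto
  have stX: "state X" using state_moves X stW by blast
  have "(\<lambda>V W. \<exists>k. move k V W)\<^sup>*\<^sup>* V X"
    using VX by (rule rtranclp_mono[THEN predicate2D, rotated]) auto
  then have UX: "(\<lambda>V W. \<exists>k. move k V W)\<^sup>*\<^sup>* U X" using V by auto
  have "layered (b(n := c)) (Suc n) X"
    unfolding layered_def
  proof (intro ballI impI)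
    fix p assume p: "p \<in> X" "fst p < Suc n" "fst (\<sigma> p) < Suc n"
    have pP: "p \<in> P" using p stX by (auto simp: state_def)
    \<comment> \<open>In the first case \<open>p\<close> belongs to a self-crossing that is not bad,
      in the second the indices decide, and in the third the crossing has not been touched.\<close>
    consider "fst p = n" | "fst p < n" "fst (\<sigma> p) = n" | "fst p < n" "fst (\<sigma> p) < n"
      using p by linarith
    then show "fst p < fst (\<sigma> p) \<or> fst p = fst (\<sigma> p) \<and>
      pos ((b(n := c)) (fst p)) (\<sigma> p) < pos ((b(n := c)) (fst p)) p"
    proof cases
      case 1
      then have "fst (\<sigma> p) = n" using p(1) X(2) unfolding mixed_def by blast
      moreover have "pos c (\<sigma> p) \<noteq> pos c p"
        using pos_inj partner_neq partner_in pP 1 calculation by metis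
      moreover have "\<not> pos c p < pos c (\<sigma> p)"
        using X(3) p(1) 1 calculation(1) unfolding bad_def by blast
      ultimately show ?thesis using 1 by auto
    next
      case 3
      then have "p \<in> V" using moves_frame[OF VX V(2) pP] p by auto
      then show ?thesis using 3 V(3) by (auto simp: layered_def)
    qed auto
  qed
  then show ?case using UX stX by blast
qed

end

section \<open>Arc changes of diagrams\<close>

definition crossing_params :: "diagram \<Rightarrow> (nat \<times> real) set" where
  "crossing_params D = (\<Union>x\<in>crossings D. fibre D x)"

text \<open>At a crossing of a link diagram the choice is forced, because all multiple points are
  double; elsewhere the value is unspecified.\<close>

definition partner :: "diagram \<Rightarrow> nat \<times> real \<Rightarrow> nat \<times> real" where
  "partner D p = (SOME q. q \<in> params D \<and> q \<noteq> p \<and> point D q = point D p)"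

section \<open>Transfer between diagrams and the combinatorial game\<close>

lemma crossing_params_iff:
  "p \<in> crossing_params D \<longleftrightarrow> p \<in> params D \<and> (\<exists>q\<in>params D. q \<noteq> p \<and> point D q = point D p)"
proof
  assume "p \<in> crossing_params D"
  then obtain x u v where "p \<in> fibre D x" "u \<in> fibre D x" "v \<in> fibre D x" "u \<noteq> v"
    unfolding crossing_params_def crossings_def by blast
  then show "p \<in> params D \<and> (\<exists>q\<in>params D. q \<noteq> p \<and> point D q = point D p)"
    unfolding fibre_def by (metis (mono_tags, lifting) mem_Collect_eq)
next
  assume "p \<in> params D \<and> (\<exists>q\<in>params D. q \<noteq> p \<and> point D q = point D p)"
  then obtain q where "q \<in> fibre D (point D p)" "p \<in> fibre D (point D p)" "q \<noteq> p"
    unfolding fibre_def by blast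
  then show "p \<in> crossing_params D" unfolding crossing_params_def crossings_def by blast
qed

lemma partner:
  assumes "p \<in> crossing_params D"
  shows "partner D p \<in> params D" "partner D p \<noteq> p" "point D (partner D p) = point D p"
  using assms someI_ex[of "\<lambda>q. q \<in> params D \<and> q \<noteq> p \<and> point D q = point D p"]
  unfolding partner_def crossing_params_iff by blast+

lemma partner_crossing_params: "p \<in> crossing_params D \<Longrightarrow> partner D p \<in> crossing_params D"
  using partner[of p D] by (metis crossing_params_iff)

lemma fibre_eq_partner:
  assumes D: "link_diagram D" and p: "p \<in> crossing_params D"
  shows "fibre D (point D p) = {p, partner D p}"
proof -
  have in_fibre: "{p, partner D p} \<subseteq> fibre D (point D p)"
    using partner[OF p] p unfolding fibre_def crossing_params_iff by simp
  then have "point D p \<in> crossings D"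
    using partner(2)[OF p] unfolding crossings_def by blast
  then have "card (fibre D (point D p)) = 2" using D by (auto simp: link_diagram_def)
  moreover have "card {p, partner D p} = 2" using partner(2)[OF p] by auto
  ultimately show ?thesis
    using in_fibre card_subset_eq[of "fibre D (point D p)" "{p, partner D p}"]
    by (metis card.infinite zero_neq_numeral)
qed

lemma partner_unique:
  assumes "link_diagram D" "p \<in> params D" "q \<in> params D" "p \<noteq> q" "point D p = point D q"
  shows "p \<in> crossing_params D" "q = partner D p"
proof -
  show p: "p \<in> crossing_params D" using assms by (auto simp: crossing_params_iff)
  have "q \<in> fibre D (point D p)" using assms by (auto simp: fibre_def)
  then show "q = partner D p" using fibre_eq_partner[OF assms(1) p] assms by auto
qed

lemma crossing_game_diagram:
  assumes D: "link_diagram D"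
  shows "crossing_game (crossing_params D) (partner D)"
proof
  have "finite (fibre D x)" if "x \<in> crossings D" for x
    using D that unfolding link_diagram_def by (metis card.infinite zero_neq_numeral)
  then show "finite (crossing_params D)"
    using D by (auto simp: crossing_params_def link_diagram_def)
  fix p assume p: "p \<in> crossing_params D"
  then show "snd p \<in> {0..<1}" by (auto simp: crossing_params_iff params_def)
  show "partner D p \<in> crossing_params D" using p by (rule partner_crossing_params)
  show "partner D p \<noteq> p" using p by (rule partner)
  show "partner D (partner D p) = p"
    using partner_unique[OF D, of "partner D p" p] partner[OF p] p by (auto simp: crossing_params_iff)
qed

lemma under_update_simps [simp]:
  "ncomps (D\<lparr>under := U\<rparr>) = ncomps D" "strand (D\<lparr>under := U\<rparr>) = strand D"
  "params (D\<lparr>under := U\<rparr>) = params D" "point (D\<lparr>under := U\<rparr>) = point D"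
  "velocity (D\<lparr>under := U\<rparr>) = velocity D" "fibre (D\<lparr>under := U\<rparr>) = fibre D"
  "crossings (D\<lparr>under := U\<rparr>) = crossings D" "crossing_params (D\<lparr>under := U\<rparr>) = crossing_params D"
  by (simp_all add: crossing_params_def params_def point_def velocity_def fibre_def crossings_def fun_eq_iff)

text \<open>The geometric conditions do not involve \<open>under\<close>, and each crossing fibre is
  a pair of partners, so valid over/under information amounts to picking one parameter of each
  pair.\<close>

lemma link_diagram_iff_state:
  assumes D: "link_diagram D"
  shows "link_diagram (D\<lparr>under := U\<rparr>) \<longleftrightarrow> crossing_game.state (crossing_params D) (partner D) U"
proof -
  interpret crossing_game "crossing_params D" "partner D" by (rule crossing_game_diagram[OF D])
  have "(\<exists>!p. p \<in> U \<inter> fibre D (point D p0)) \<longleftrightarrow> (partner D p0 \<in> U \<longleftrightarrow> p0 \<notin> U)"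
    if "p0 \<in> crossing_params D" for p0
    using partner(2)[OF that] unfolding fibre_eq_partner[OF D that] Int_iff insert_iff empty_iff
    by metis
  moreover have "crossings D = point D ` crossing_params D"
  proof
    show "crossings D \<subseteq> point D ` crossing_params D"
    proof
      fix x assume x: "x \<in> crossings D"
      then obtain u where "u \<in> fibre D x" unfolding crossings_def by blast
      then have "u \<in> crossing_params D" "x = point D u"
        using x unfolding crossing_params_def fibre_def by blast+
      then show "x \<in> point D ` crossing_params D" by (rule rev_image_eqI)
    qed
    show "point D ` crossing_params D \<subseteq> crossings D"
      unfolding crossing_params_def fibre_def by blast
  qed
  ultimately have "(\<forall>x\<in>crossings D. \<exists>!p. p \<in> U \<inter> fibre D x) \<longleftrightarrow>
      (\<forall>p\<in>crossing_params D. partner D p \<in> U \<longleftrightarrow> p \<notin> U)"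
    by (simp add: Int_commute)
  then show ?thesis
    using D unfolding link_diagram_def state_def crossing_params_def[symmetric] by simp
qed

lemma strand_frac:
  assumes "link_diagram D" "i < ncomps D"
  shows "strand D i (frac t) = strand D i t"
proof -
  have per: "strand D i (x + 1) = strand D i x" for x using assms by (auto simp: link_diagram_def)
  have nat: "strand D i (x + real n) = strand D i x" for x n
  proof (induction n)
    case (Suc n)
    then show ?case using per[of "x + real n"] by (simp add: algebra_simps)
  qed simp
  show ?thesis
  proof (cases "\<lfloor>t\<rfloor> \<ge> 0")
    case True
    then have "frac t + real (nat \<lfloor>t\<rfloor>) = t" by (simp add: frac_def)
    then show ?thesis using nat[of "frac t" "nat \<lfloor>t\<rfloor>"] by simp
  next
    case False
    then have "t + real (nat (- \<lfloor>t\<rfloor>)) = frac t" by (simp add: frac_def)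
    then show ?thesis using nat[of t "nat (- \<lfloor>t\<rfloor>)"] by simp
  qed
qed

text \<open>\<open>switch\<close> selects crossings by points of the plane, \<open>flip\<close> by
  parameters. The two selections agree because the fibre over a crossing is a pair of
  partners.\<close>

lemma arc_change_I_move:
  assumes D: "link_diagram D"
    and U: "crossing_game.state (crossing_params D) (partner D) U"
    and m: "crossing_game.move (crossing_params D) (partner D) k U V"
  shows "arc_change_I (D\<lparr>under := U\<rparr>) (D\<lparr>under := V\<rparr>)"
proof -
  interpret crossing_game "crossing_params D" "partner D" by (rule crossing_game_diagram[OF D])
  obtain s t where st: "arc U k s t" and V: "V = flip (k, frac s) (k, frac t) U"
    using m unfolding move_def by blast
  let ?p = "(k, frac s)" and ?q = "(k, frac t)"
  have pq: "?p \<in> crossing_params D" "?q \<in> crossing_params D"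
    using st U by (auto simp: arc_def state_def)
  then have k: "k < ncomps D" by (auto simp: crossing_params_iff params_def)
  have "is_arc (D\<lparr>under := U\<rparr>) k s t" using st k by (auto simp: is_arc_def arc_def)
  moreover have "switch {strand D k s, strand D k t} (D\<lparr>under := U\<rparr>) = D\<lparr>under := V\<rparr>"
  proof -
    have pts: "strand D k s = point D ?p" "strand D k t = point D ?q"
      using strand_frac[OF D k] by (simp_all add: point_def)
    have "point D x \<in> {strand D k s, strand D k t} \<longleftrightarrow> x \<in> {?p, partner D ?p, ?q, partner D ?q}"
      if "x \<in> crossing_params D" for x
    proof -
      have "x \<in> params D" using that by (simp add: crossing_params_iff)
      then have "point D x = point D y \<longleftrightarrow> x \<in> {y, partner D y}" if "y \<in> crossing_params D" for y
        using fibre_eq_partner[OF D that] by (auto simp: fibre_def)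
      then show ?thesis unfolding pts using pq by simp
    qed
    then have "{x \<in> crossing_params D. if point D x \<in> {strand D k s, strand D k t} then x \<notin> U else x \<in> U} = V"
      unfolding V flip_def by (intro Collect_cong conj_cong refl) presburger
    then show ?thesis
      unfolding switch_def by (simp add: crossing_params_def[symmetric] cong: if_cong split del: if_split)
  qed
  ultimately show ?thesis unfolding arc_change_I_def by force
qed

lemma ex_layered_diagram:
  assumes D: "link_diagram D"
  shows "\<exists>U b. arc_change_I\<^sup>*\<^sup>* D (D\<lparr>under := U\<rparr>) \<and> link_diagram (D\<lparr>under := U\<rparr>) \<and>
    (\<forall>p\<in>U. \<forall>q\<in>params D. p \<noteq> q \<and> point D p = point D q \<longrightarrow>
       fst p < fst q \<or> fst p = fst q \<and> frac (snd q - b (fst p)) < frac (snd p - b (fst p)))"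
proof -
  interpret crossing_game "crossing_params D" "partner D" by (rule crossing_game_diagram[OF D])
  have st: "state (under D)" using link_diagram_iff_state[OF D, of "under D"] D by simp
  obtain U b where U: "(\<lambda>V W. \<exists>k. move k V W)\<^sup>*\<^sup>* (under D) U" "state U" "layered b (ncomps D) U"
    using ex_layered[OF st] by blast
  from U(1) have "arc_change_I\<^sup>*\<^sup>* D (D\<lparr>under := U\<rparr>) \<and> state U"
  proof (induction rule: rtranclp_induct)
    case (step V W)
    then show ?case
      using arc_change_I_move[OF D] state_move rtranclp.rtrancl_into_rtrancl[of arc_change_I] by blast
  qed (use st in simp)
  moreover have lay: "fst p < fst q \<or> fst p = fst q \<and> frac (snd q - b (fst p)) < frac (snd p - b (fst p))"
    if p: "p \<in> U" and q: "q \<in> params D" "p \<noteq> q" "point D p = point D q" for p q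
  proof -
    have pc: "p \<in> crossing_params D" using p U(2) by (auto simp: state_def)
    then have "p \<in> params D" by (simp add: crossing_params_iff)
    then have "q = partner D p" "fst p < ncomps D" "fst q < ncomps D"
      using partner_unique[OF D _ q] q by (auto simp: params_def)
    then show ?thesis using U(3) p by (auto simp: layered_def pos_def)
  qed
  ultimately show ?thesis
    using link_diagram_iff_state[OF D, of U] by (intro exI[of _ U] exI[of _ b]) (simp add: lay)
qed

section \<open>Level-preserving isotopies\<close>

lemma has_vector_derivative_imp_slope:
  fixes F :: "real \<Rightarrow> 'a::real_normed_vector"
  assumes "(F has_vector_derivative v) (at a)"
  shows "((\<lambda>t. (F t - F a) /\<^sub>R (t - a)) \<longlongrightarrow> v) (at a)"
proof -
  have "((\<lambda>t. norm ((F t - F a) - (t - a) *\<^sub>R v) / norm (t - a)) \<longlongrightarrow> 0) (at a)"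
    using assms by (simp add: has_vector_derivative_def has_derivative_iff_norm)
  then have "((\<lambda>t. norm ((F t - F a) /\<^sub>R (t - a) - v)) \<longlongrightarrow> 0) (at a)"
  proof (rule Lim_transform_eventually)
    have "norm ((F t - F a) - (t - a) *\<^sub>R v) / norm (t - a) = norm ((F t - F a) /\<^sub>R (t - a) - v)"
      if "t \<noteq> a" for t
    proof -
      have "(F t - F a) /\<^sub>R (t - a) - v = ((F t - F a) - (t - a) *\<^sub>R v) /\<^sub>R (t - a)"
        using that by (simp add: scaleR_diff_right)
      then show ?thesis by (simp add: divide_inverse mult.commute)
    qed
    then show "\<forall>\<^sub>F t in at a. norm ((F t - F a) - (t - a) *\<^sub>R v) / norm (t - a)
        = norm ((F t - F a) /\<^sub>R (t - a) - v)"
      by (auto simp: eventually_at_filter)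
  qed
  then show ?thesis by (simp add: LIM_zero_iff tendsto_norm_zero_iff)
qed

text \<open>L'Hopital's rule for a complex numerator: both functions are divided by
  \<open>t - a\<close>.\<close>

lemma slope_quotient_tendsto:
  fixes F :: "real \<Rightarrow> complex" and S :: "real \<Rightarrow> real"
  assumes "(F has_vector_derivative v) (at a)" "(S has_real_derivative w) (at a)"
    and "F a = 0" "S a = 0" "w \<noteq> 0"
  shows "((\<lambda>t. F t / S t) \<longlongrightarrow> v / w) (at a)"
proof -
  have "((\<lambda>t. F t /\<^sub>R (t - a)) \<longlongrightarrow> v) (at a)"
    using has_vector_derivative_imp_slope[OF assms(1)] assms(3) by simp
  moreover have "((\<lambda>t. S t / (t - a)) \<longlongrightarrow> w) (at a)"
    using assms(2,4) by (simp add: has_field_derivative_iff)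
  then have "((\<lambda>t. complex_of_real (S t / (t - a))) \<longlongrightarrow> w) (at a)" by (rule tendsto_of_real)
  ultimately have "((\<lambda>t. (F t /\<^sub>R (t - a)) / complex_of_real (S t / (t - a))) \<longlongrightarrow> v / w) (at a)"
    using assms(5) by (intro tendsto_divide) auto
  then show ?thesis
  proof (rule Lim_transform_eventually)
    have "(F t /\<^sub>R (t - a)) / complex_of_real (S t / (t - a)) = F t / S t" if "t \<noteq> a" for t
    proof -
      have "complex_of_real (t - a) \<noteq> 0" using that by simp
      then show ?thesis by (simp add: scaleR_conv_of_real field_simps del: of_real_diff)
    qed
    then show "\<forall>\<^sub>F t in at a. (F t /\<^sub>R (t - a)) / complex_of_real (S t / (t - a)) = F t / S t"
      by (auto simp: eventually_at_filter)
  qed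
qed

text \<open>Between consecutive integers the function is a translate of \<open>g\<close>, and the
  equal end values cover the right endpoint. Every real number is interior to the union of two
  neighbouring closed intervals of this kind.\<close>

lemma continuous_on_frac:
  fixes g :: "real \<Rightarrow> 'a::topological_space"
  assumes g: "continuous_on {0..1} g" and "g 0 = g 1"
  shows "continuous_on UNIV (\<lambda>t. g (frac t))"
proof -
  have shifted: "continuous_on {real_of_int n..real_of_int n + 1} (\<lambda>t. g (frac t))" for n
  proof -
    have "continuous_on {real_of_int n..real_of_int n + 1} (\<lambda>t. g (t - real_of_int n))"
      by (rule continuous_on_compose2[OF g]) (auto intro!: continuous_intros)
    moreover have "g (frac t) = g (t - real_of_int n)" if "t \<in> {real_of_int n..real_of_int n + 1}" for t
    proof (cases "t = real_of_int n + 1")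
      case True then show ?thesis using assms(2) by (simp add: frac_def)
    next
      case False
      then have "\<lfloor>t\<rfloor> = n" using that by (auto simp: floor_eq_iff)
      then show ?thesis by (simp add: frac_def)
    qed
    ultimately show ?thesis by (metis (no_types, lifting) continuous_on_eq)
  qed
  have "isCont (\<lambda>t. g (frac t)) t" for t
  proof -
    let ?n = "\<lfloor>t\<rfloor>"
    have "continuous_on ({real_of_int (?n - 1)..real_of_int (?n - 1) + 1} \<union> {real_of_int ?n..real_of_int ?n + 1}) (\<lambda>t. g (frac t))"
      by (intro continuous_on_closed_Un shifted) auto
    moreover have "{real_of_int (?n - 1)..real_of_int (?n - 1) + 1} \<union> {real_of_int ?n..real_of_int ?n + 1}
      = {real_of_int ?n - 1..real_of_int ?n + 1}" by auto
    moreover have "t \<in> interior {real_of_int ?n - 1..real_of_int ?n + 1}"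
      by (simp add: interior_atLeastAtMost_real) linarith
    ultimately show ?thesis by (metis continuous_on_interior)
  qed
  then show ?thesis by (simp add: continuous_at_imp_continuous_on)
qed

text \<open>
  The two points of the curve at level \<open>cos \<theta>\<close> are \<open>\<gamma> (b + (1 - e) \<theta> / pi)\<close> on the descending part
  and \<open>\<gamma> (b + 1 - e \<theta> / pi)\<close> on the ascending part.  They collide at the two extreme levels, but the
  quotient of their difference by \<open>sin \<theta>\<close> has nonzero limits there because \<open>\<gamma>\<close> is regular.
\<close>

lemma ex_level_similarities:
  fixes \<gamma> :: "real \<Rightarrow> complex"
  assumes C1: "\<gamma> C1_differentiable_on UNIV" and per: "\<And>t. \<gamma> (t + 1) = \<gamma> t"
    and reg: "\<And>t. vector_derivative \<gamma> (at t) \<noteq> 0" and e: "0 < e" "e < 1"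
    and inj: "\<And>\<theta>. 0 < \<theta> \<Longrightarrow> \<theta> < pi \<Longrightarrow> \<gamma> (b + (1 - e) * \<theta> / pi) \<noteq> \<gamma> (b + 1 - e * \<theta> / pi)"
  shows "\<exists>c d :: real \<Rightarrow> complex. continuous_on UNIV c \<and> continuous_on UNIV d \<and>
    (\<forall>\<theta>\<in>{0..pi}. exp (c (cos \<theta>)) * \<gamma> (b + (1 - e) * \<theta> / pi) + d (cos \<theta>) = \<i> * sin \<theta> \<and>
      exp (c (cos \<theta>)) * \<gamma> (b + 1 - e * \<theta> / pi) + d (cos \<theta>) = - (\<i> * sin \<theta>))"
proof -
  define p where "p \<theta> = \<gamma> (b + (1 - e) * \<theta> / pi)" for \<theta>
  define q where "q \<theta> = \<gamma> (b + 1 - e * \<theta> / pi)" for \<theta>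
  define F where "F \<theta> = q \<theta> - p \<theta>" for \<theta>
  have der: "(\<gamma> has_vector_derivative vector_derivative \<gamma> (at t)) (at t)" for t
    using C1 by (simp add: C1_differentiable_on_eq vector_derivative_works[symmetric])
  have cont: "continuous_on A \<gamma>" for A
    by (intro continuous_at_imp_continuous_on ballI has_vector_derivative_continuous[OF der])
  have Fder: "(F has_vector_derivative
      (- e / pi) *\<^sub>R vector_derivative \<gamma> (at (b + 1 - e * \<theta> / pi)) -
      ((1 - e) / pi) *\<^sub>R vector_derivative \<gamma> (at (b + (1 - e) * \<theta> / pi))) (at \<theta>)" for \<theta>
  proof -
    have "((\<gamma> \<circ> (\<lambda>\<theta>. b + 1 - e * \<theta> / pi)) has_vector_derivative
        (- e / pi) *\<^sub>R vector_derivative \<gamma> (at (b + 1 - e * \<theta> / pi))) (at \<theta>)"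
      by (rule vector_diff_chain_at[OF _ der]) (auto intro!: derivative_eq_intros simp: has_real_derivative_iff_has_vector_derivative[symmetric])
    moreover have "((\<gamma> \<circ> (\<lambda>\<theta>. b + (1 - e) * \<theta> / pi)) has_vector_derivative
        ((1 - e) / pi) *\<^sub>R vector_derivative \<gamma> (at (b + (1 - e) * \<theta> / pi))) (at \<theta>)"
      by (rule vector_diff_chain_at[OF _ der]) (auto intro!: derivative_eq_intros simp: has_real_derivative_iff_has_vector_derivative[symmetric])
    ultimately show ?thesis
      unfolding F_def p_def q_def o_def by (rule has_vector_derivative_diff)
  qed
  \<comment> \<open>At the top level the parameters \<open>b\<close> and \<open>b + 1\<close> have
    the same velocity. As \<open>e\<close> and \<open>1 - e\<close> add up to 1, the derivative of
    \<open>F\<close> there is a nonzero multiple of it.\<close>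
  have "vector_derivative \<gamma> (at (b + 1)) = vector_derivative \<gamma> (at b)"
  proof -
    have "((\<gamma> \<circ> (\<lambda>t. t + 1)) has_vector_derivative 1 *\<^sub>R vector_derivative \<gamma> (at (b + 1))) (at b)"
      by (rule vector_diff_chain_at[OF _ der]) (auto intro!: derivative_eq_intros)
    moreover have "\<gamma> \<circ> (\<lambda>t. t + 1) = \<gamma>" using per by auto
    ultimately show ?thesis by (simp add: vector_derivative_at)
  qed
  moreover have sum: "(- e / pi) *\<^sub>R v - ((1 - e) / pi) *\<^sub>R v = (- 1 / pi) *\<^sub>R v" for v :: complex
    by (subst scaleR_diff_left[symmetric]) (simp add: diff_divide_distrib)
  ultimately have F0: "(F has_vector_derivative (- 1 / pi) *\<^sub>R vector_derivative \<gamma> (at b)) (at 0)"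
    using Fder[of 0] sum[of "vector_derivative \<gamma> (at b)"] by simp
  have ends: "b + 1 - e = b + (1 - e)" by simp
  have F1: "(F has_vector_derivative (- 1 / pi) *\<^sub>R vector_derivative \<gamma> (at (b + (1 - e)))) (at pi)"
    using Fder[of pi] sum[of "vector_derivative \<gamma> (at (b + (1 - e)))"] by (simp add: ends)
  have Fz: "F 0 = 0" "F pi = 0" using per[of b] by (simp_all add: F_def p_def q_def ends)
  define L0 where "L0 = (- 1 / pi) *\<^sub>R vector_derivative \<gamma> (at b)"
  \<comment> \<open>The divisor \<open>- 1\<close> is the derivative of \<open>sin\<close> at
    \<open>pi\<close>.\<close>
  define L1 where "L1 = (- 1 / pi) *\<^sub>R vector_derivative \<gamma> (at (b + (1 - e))) / complex_of_real (- 1)"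
  define G where "G \<theta> = (if \<theta> = 0 then L0 else if \<theta> = pi then L1 else F \<theta> / sin \<theta>)" for \<theta>
  have lim0: "((\<lambda>\<theta>. F \<theta> / sin \<theta>) \<longlongrightarrow> L0) (at 0)"
    using slope_quotient_tendsto[OF F0, of sin 1] DERIV_sin[of 0] Fz by (simp add: L0_def)
  have lim1: "((\<lambda>\<theta>. F \<theta> / sin \<theta>) \<longlongrightarrow> L1) (at pi)"
    using slope_quotient_tendsto[OF F1, of sin "- 1"] DERIV_sin[of pi] Fz by (simp add: L1_def)
  have Fcont: "isCont F \<theta>" for \<theta> using Fder has_vector_derivative_continuous by blast
  have "isCont G \<theta>" if \<theta>: "\<theta> \<in> {0..pi}" for \<theta>
  proof -
    have ev: "\<forall>\<^sub>F x in at \<theta>. x \<noteq> 0 \<and> x \<noteq> pi"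
      using eventually_neq_at_within[of 0 \<theta> UNIV] eventually_neq_at_within[of pi \<theta> UNIV] by eventually_elim auto
    have "((\<lambda>\<theta>. F \<theta> / sin \<theta>) \<longlongrightarrow> G \<theta>) (at \<theta>)"
    proof (cases "\<theta> = 0 \<or> \<theta> = pi")
      case True then show ?thesis using lim0 lim1 by (auto simp: G_def)
    next
      case False
      then have "sin \<theta> \<noteq> 0" using \<theta> sin_gt_zero[of \<theta>] by auto
      then have "isCont (\<lambda>\<theta>. F \<theta> / sin \<theta>) \<theta>" using Fcont by (intro continuous_intros) auto
      then show ?thesis using False by (simp add: isCont_def G_def)
    qed
    then show ?thesis
      unfolding isCont_def
      by (rule Lim_transform_eventually) (use ev in eventually_elim, simp add: G_def)
  qed
  then have "continuous_on {0..pi} G" by (simp add: continuous_at_imp_continuous_on)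
  moreover have Gnz: "G \<theta> \<noteq> 0" if "\<theta> \<in> {0..pi}" for \<theta>
  proof (cases "\<theta> = 0 \<or> \<theta> = pi")
    case True then show ?thesis using reg by (auto simp: G_def L0_def L1_def)
  next
    case False
    then have "0 < \<theta>" "\<theta> < pi" using that by auto
    then show ?thesis using inj[of \<theta>] sin_gt_zero[of \<theta>] False by (simp add: G_def F_def p_def q_def)
  qed
  \<comment> \<open>On an interval the nonvanishing \<open>G\<close> has a continuous logarithm, so
    the multipliers take the form \<open>exp\<close>, which can be deformed to 1 by scaling the
    exponent.\<close>
  moreover have "contractible {0..pi}" by (intro convex_imp_contractible) auto
  ultimately obtain g where g: "continuous_on {0..pi} g" "\<And>\<theta>. \<theta> \<in> {0..pi} \<Longrightarrow> G \<theta> = exp (g \<theta>)"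
    using continuous_logarithm_on_contractible by blast
  have FG: "F \<theta> = G \<theta> * sin \<theta>" if "\<theta> \<in> {0..pi}" for \<theta>
  proof (cases "\<theta> = 0 \<or> \<theta> = pi")
    case True then show ?thesis using Fz by auto
  next
    case False
    then have "sin \<theta> \<noteq> 0" using that sin_gt_zero[of \<theta>] by auto
    then show ?thesis using False by (simp add: G_def)
  qed
  \<comment> \<open>Clamping extends the angle, and with it \<open>c\<close> and \<open>d\<close>,
    continuously to all heights.\<close>
  define ac where "ac y = arccos (max (- 1) (min 1 y))" for y
  have ac_range: "ac y \<in> {0..pi}" for y
    unfolding ac_def by (simp add: arccos_lbound arccos_ubound)
  have ac_cont: "continuous_on UNIV ac"
    unfolding ac_def by (intro continuous_on_arccos continuous_intros) auto
  have ac_cos: "ac (cos \<theta>) = \<theta>" if "\<theta> \<in> {0..pi}" for \<theta>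
    using that by (simp add: ac_def arccos_cos)
  \<comment> \<open>The factor turns the difference of the two points into
    \<open>- 2 * \<i> * sin \<theta>\<close>, and \<open>d\<close> moves their midpoint to
    zero.\<close>
  define c where "c y = Ln (- 2 * \<i>) - g (ac y)" for y
  define d where "d y = - exp (c y) * (p (ac y) + q (ac y)) / 2" for y
  have c: "continuous_on UNIV c"
    unfolding c_def
    by (intro continuous_on_diff continuous_on_const continuous_on_compose2[OF g(1) ac_cont]) (use ac_range in auto)
  have d: "continuous_on UNIV d"
    unfolding d_def p_def q_def
    by (intro continuous_intros c continuous_on_compose2[OF cont[of UNIV]] ac_cont) auto
  have "exp (c (cos \<theta>)) * p \<theta> + d (cos \<theta>) = \<i> * sin \<theta> \<and> exp (c (cos \<theta>)) * q \<theta> + d (cos \<theta>) = - (\<i> * sin \<theta>)"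
    if \<theta>: "\<theta> \<in> {0..pi}" for \<theta>
  proof -
    have "exp (c (cos \<theta>)) = - 2 * \<i> / G \<theta>"
      using g(2)[OF \<theta>] by (simp add: c_def ac_cos[OF \<theta>] exp_diff)
    then have "exp (c (cos \<theta>)) * F \<theta> = - 2 * \<i> * sin \<theta>"
      using FG[OF \<theta>] Gnz[OF \<theta>] by simp
    then have q: "exp (c (cos \<theta>)) * q \<theta> = exp (c (cos \<theta>)) * p \<theta> - 2 * \<i> * sin \<theta>"
      unfolding F_def by (simp add: algebra_simps)
    then have "d (cos \<theta>) = - exp (c (cos \<theta>)) * p \<theta> + \<i> * sin \<theta>"
      by (simp add: d_def ac_cos[OF \<theta>] distrib_left diff_divide_distrib)
    then show ?thesis using q by simp
  qed
  then show ?thesis using c d unfolding p_def q_def by blast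
qed

text \<open>Rotation of 3-space in the plane of the real part and the height. A quarter turn lays
  the vertical circles flat at height zero, where the standard unlink lies.\<close>

definition turn :: "real \<Rightarrow> complex \<times> real \<Rightarrow> complex \<times> real" where
  "turn a = (\<lambda>(w, y). (Complex (Re w * cos a + y * sin a) (Im w), y * cos a - Re w * sin a))"

lemma continuous_on_turn [continuous_intros]:
  fixes a :: "'a::t2_space \<Rightarrow> real"
  assumes "continuous_on S a" "continuous_on S f"
  shows "continuous_on S (\<lambda>x. turn (a x) (f x))"
  unfolding turn_def case_prod_unfold Complex_eq
  using assms by (intro continuous_intros)

lemma turn_turn: "turn (- a) (turn a v) = v"
proof -
  have "(x * cos a + y * sin a) * cos a - (y * cos a - x * sin a) * sin a = x * ((sin a)\<^sup>2 + (cos a)\<^sup>2)"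
    "(y * cos a - x * sin a) * cos a + (x * cos a + y * sin a) * sin a = y * ((sin a)\<^sup>2 + (cos a)\<^sup>2)" for x y
    by algebra+
  then show ?thesis
    by (cases v) (simp add: turn_def complex_eq_iff)
qed

text \<open>Scaling \<open>c\<close>, \<open>d\<close> and the angle by \<open>s\<close> joins the
  identity to the map. Each stage has an explicit continuous inverse, because \<open>exp\<close>
  never vanishes and the rotation can be undone.\<close>

lemma ambient_isotopic_level_similarity:
  fixes c d :: "real \<Rightarrow> complex"
  assumes c: "continuous_on UNIV c" and d: "continuous_on UNIV d"
  shows "ambient_isotopic K ((\<lambda>(z, y). turn (pi / 2) (exp (c y) * z + d y, y)) ` K)"
proof -
  define H where "H v = turn (fst v * (pi / 2))
      (exp (fst v * c (snd (snd v))) * fst (snd v) + fst v * d (snd (snd v)), snd (snd v))"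
    for v :: "real \<times> complex \<times> real"
  have comp: "continuous_on UNIV (\<lambda>v :: real \<times> complex \<times> real. c (snd (snd v)))"
    "continuous_on UNIV (\<lambda>v :: real \<times> complex \<times> real. d (snd (snd v)))"
    by (intro continuous_on_compose2[OF c] continuous_on_compose2[OF d] continuous_intros; simp)+
  have H: "continuous_on UNIV H"
    unfolding H_def by (intro continuous_intros comp)
  have homeo: "homeomorphism UNIV UNIV (\<lambda>x. H (s, x))
     (\<lambda>x. let v = turn (- (s * (pi / 2))) x in ((fst v - s * d (snd v)) * exp (- (s * c (snd v))), snd v))"
    (is "homeomorphism _ _ _ ?g") for s
  proof -
    have "continuous_on UNIV (\<lambda>x. H (s, x))"
      by (intro continuous_on_compose2[OF H] continuous_intros) auto
    moreover have "continuous_on UNIV ?g"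
    proof -
      have t: "continuous_on UNIV (\<lambda>x. snd (turn (- (s * (pi / 2))) x))" by (intro continuous_intros)
      show ?thesis
        unfolding Let_def
        by (intro continuous_intros continuous_on_compose2[OF c t] continuous_on_compose2[OF d t]) auto
    qed
    moreover have cancel: "exp w * z * exp (- w) = z" for w z :: complex
      by (simp add: exp_minus)
    have "?g (H (s, x)) = x" for x
      by (cases x) (simp add: H_def turn_turn Let_def cancel)
    moreover have "H (s, ?g x) = x" for x
    proof -
      have cancel': "exp w * (z * exp (- w)) = z" for w z :: complex
        by (simp add: exp_minus)
      show ?thesis
        using turn_turn[of "- (s * (pi / 2))" x] by (simp add: H_def Let_def cancel')
    qed
    ultimately show ?thesis
      by (intro homeomorphismI) auto
  qed
  have "homotopic_with_canon (\<lambda>f. \<exists>g. homeomorphism UNIV UNIV f g) UNIV UNIV id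
      (\<lambda>(z, y). turn (pi / 2) (exp (c y) * z + d y, y))"
    unfolding homotopic_with_def
  proof (intro exI[of _ H] conjI ballI allI)
    show "continuous_map (prod_topology (top_of_set {0..1}) (top_of_set UNIV)) (top_of_set UNIV) H"
      unfolding prod_topology_subtopology_eu using continuous_on_subset[OF H] by simp
    show "H (0, x) = id x" for x by (simp add: H_def turn_def complex_eq_iff)
    show "H (1, x) = (\<lambda>(z, y). turn (pi / 2) (exp (c y) * z + d y, y)) x" for x
      by (simp add: H_def case_prod_unfold)
    show "\<exists>g. homeomorphism UNIV UNIV (\<lambda>x. H (s, x)) g" for s using homeo by blast
  qed
  then show ?thesis unfolding ambient_isotopic_def by blast
qed

text \<open>Cutoff functions combine the data of the separate slabs into one map on all heights, so
  that a single isotopy moves all components.\<close>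

lemma glue_levels:
  fixes f :: "nat \<Rightarrow> real \<Rightarrow> complex"
  assumes f: "\<And>i. i < n \<Longrightarrow> continuous_on UNIV (f i)"
  shows "\<exists>F. continuous_on UNIV F \<and> (\<forall>i<n. \<forall>y\<in>{-1..1}. F (3 * real i + y) = f i y)"
proof -
  \<comment> \<open>Equal to 1 within distance 1 of \<open>3 * real i\<close> and 0 from distance 2
    on; every other slab keeps at least that distance from this centre.\<close>
  define \<phi> where "\<phi> i y = max 0 (1 - max 0 (\<bar>y - 3 * real i\<bar> - 1))" for i y
  define F where "F y = (\<Sum>i<n. complex_of_real (\<phi> i y) * f i (y - 3 * real i))" for y
  have "continuous_on UNIV F"
    unfolding F_def \<phi>_def
    by (intro continuous_intros continuous_on_compose2[OF f]) auto
  moreover have "F (3 * real i + y) = f i y" if i: "i < n" and y: "y \<in> {-1..1}" for i y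
  proof -
    have "\<phi> j (3 * real i + y) = (if j = i then 1 else 0)" for j
    proof (cases "j = i")
      case False
      then have "\<bar>real i - real j\<bar> \<ge> 1" by linarith
      then have "\<bar>3 * real i + y - 3 * real j\<bar> \<ge> 2" using y by (auto simp: abs_if split: if_splits)
      then show ?thesis using False by (simp add: \<phi>_def)
    qed (use y in \<open>auto simp: \<phi>_def\<close>)
    then have "F (3 * real i + y) = (\<Sum>j<n. if j = i then f i y else 0)"
      unfolding F_def by (intro sum.cong) auto
    then show ?thesis using i by simp
  qed
  ultimately show ?thesis by blast
qed

section \<open>Layered diagrams represent unlinks\<close>

text \<open>Angle as a function of time: it rises from 0 to \<open>pi\<close> until time
  \<open>1 - e\<close> and is back at 0 at time 1, inverting the two level parametrisations.\<close>

definition tent :: "real \<Rightarrow> real \<Rightarrow> real" where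
  "tent e u = min (pi * u / (1 - e)) (pi * (1 - u) / e)"

lemma tent_left:
  assumes "0 < e" "e < 1" "u \<le> 1 - e"
  shows "tent e u = pi * u / (1 - e)"
proof -
  have "u / (1 - e) \<le> 1" "1 \<le> (1 - u) / e" using assms by (auto simp: field_simps)
  then have "pi * (u / (1 - e)) \<le> pi * ((1 - u) / e)" by (intro mult_left_mono) auto
  then show ?thesis by (simp add: tent_def min_def)
qed

lemma tent_right:
  assumes "0 < e" "e < 1" "1 - e \<le> u"
  shows "tent e u = pi * (1 - u) / e"
proof -
  have "1 \<le> u / (1 - e)" "(1 - u) / e \<le> 1" using assms by (auto simp: field_simps)
  then have "pi * ((1 - u) / e) \<le> pi * (u / (1 - e))" by (intro mult_left_mono) auto
  then show ?thesis by (simp add: tent_def min_def)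
qed

lemma turn_half_pi:
  "turn (pi / 2) (\<i> * complex_of_real r, y) = (Complex y r, 0)"
  "turn (pi / 2) (- (\<i> * complex_of_real r), y) = (Complex y (- r), 0)"
  by (simp_all add: turn_def)

lemma circle_param:
  "sphere (complex_of_real x) 1 =
    (\<lambda>\<theta>. Complex (x + cos \<theta>) (sin \<theta>)) ` {0..pi} \<union> (\<lambda>\<theta>. Complex (x + cos \<theta>) (- sin \<theta>)) ` {0..pi}"
  (is "?S = ?A \<union> ?B")
proof
  have on: "Complex (x + cos \<theta>) s \<in> ?S" if "s\<^sup>2 = (sin \<theta>)\<^sup>2" for \<theta> s
    using that by (simp add: dist_complex_def cmod_def)
  then show "?A \<union> ?B \<subseteq> ?S" by auto
  show "?S \<subseteq> ?A \<union> ?B"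
  proof
    fix w assume "w \<in> ?S"
    then have eq: "(Re w - x)\<^sup>2 + (Im w)\<^sup>2 = 1"
      by (simp add: dist_complex_def cmod_def power2_commute)
    then have "(Re w - x)\<^sup>2 \<le> 1" by (metis add_increasing2 le_add_same_cancel1 order_refl zero_le_power2)
    then have bd: "- 1 \<le> Re w - x" "Re w - x \<le> 1" by (auto simp: abs_square_le_1 abs_le_iff)
    define \<theta> where "\<theta> = arccos (Re w - x)"
    have \<theta>: "\<theta> \<in> {0..pi}" "cos \<theta> = Re w - x"
      using bd by (auto simp: \<theta>_def arccos_lbound arccos_ubound)
    have "sin \<theta> \<ge> 0" using \<theta> by (simp add: sin_ge_zero)
    moreover have "(sin \<theta>)\<^sup>2 = (Im w)\<^sup>2" using eq \<theta>(2) by (simp add: sin_squared_eq)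
    ultimately have "sin \<theta> = Im w \<or> sin \<theta> = - Im w" by (simp add: power2_eq_iff)
    then have "w = Complex (x + cos \<theta>) (sin \<theta>) \<or> w = Complex (x + cos \<theta>) (- sin \<theta>)"
      using \<theta>(2) by (auto simp: complex_eq_iff)
    then show "w \<in> ?A \<union> ?B" using \<theta>(1) by blast
  qed
qed

text \<open>Regroups the curve by level instead of by time, the form to which the similarities of
  the levels apply.\<close>

lemma range_tent_curve:
  assumes D: "link_diagram D" "i < ncomps D" and e: "0 < e" "e < 1"
  shows "range (\<lambda>t. (strand D i t, x + cos (tent e (frac (t - b))))) =
    (\<lambda>\<theta>. (strand D i (b + (1 - e) * \<theta> / pi), x + cos \<theta>)) ` {0..pi} \<union>
    (\<lambda>\<theta>. (strand D i (b + 1 - e * \<theta> / pi), x + cos \<theta>)) ` {0..pi}"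
  (is "range ?f = ?A \<union> ?B")
proof
  show "range ?f \<subseteq> ?A \<union> ?B"
  proof (rule image_subsetI)
    fix t
    define u where "u = frac (t - b)"
    have u: "0 \<le> u" "u < 1" by (auto simp: u_def frac_lt_1)
    have strand: "strand D i t = strand D i (b + u)"
      using strand_frac[OF D, of t] strand_frac[OF D, of "b + u"] frac_add_frac_diff[of b t] by (simp add: u_def)
    show "?f t \<in> ?A \<union> ?B"
    proof (cases "u \<le> 1 - e")
      case True
      then have "u / (1 - e) \<le> 1" using e by (simp add: field_simps)
      then have "pi * (u / (1 - e)) \<le> pi" using mult_left_mono[of "u / (1 - e)" 1 pi] by simp
      then have "tent e u \<in> {0..pi}" "(1 - e) * tent e u / pi = u"
        using tent_left[OF e True] e u by auto
      then have "?f t \<in> ?A"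
        using strand by (intro image_eqI[of _ _ "tent e u"]) (auto simp: u_def)
      then show ?thesis ..
    next
      case False
      then have "(1 - u) / e \<le> 1" using e by (simp add: field_simps)
      then have "pi * ((1 - u) / e) \<le> pi" using mult_left_mono[of "(1 - u) / e" 1 pi] by simp
      then have "tent e u \<in> {0..pi}" "e * tent e u / pi = 1 - u"
        using tent_right[OF e, of u] e u False by auto
      then have "?f t \<in> ?B"
        using strand by (intro image_eqI[of _ _ "tent e u"]) (auto simp: u_def)
      then show ?thesis ..
    qed
  qed
next
  have left: "?f (b + (1 - e) * \<theta> / pi) = (strand D i (b + (1 - e) * \<theta> / pi), x + cos \<theta>)"
    if \<theta>: "\<theta> \<in> {0..pi}" for \<theta>
  proof -
    define u where "u = (1 - e) * (\<theta> / pi)"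
    have "\<theta> / pi \<le> 1" using \<theta> by simp
    then have "(1 - e) * (\<theta> / pi) \<le> (1 - e) * 1" using e by (intro mult_left_mono) auto
    then have u: "0 \<le> u" "u \<le> 1 - e" using \<theta> e by (auto simp: u_def)
    then have "frac u = u" using e by (simp add: frac_eq)
    moreover have "tent e u = \<theta>" using tent_left[OF e u(2)] e by (simp add: u_def)
    ultimately show ?thesis by (simp add: u_def)
  qed
  have right: "?f (b + 1 - e * \<theta> / pi) = (strand D i (b + 1 - e * \<theta> / pi), x + cos \<theta>)"
    if \<theta>: "\<theta> \<in> {0..pi}" for \<theta>
  proof -
    define u where "u = 1 - e * (\<theta> / pi)"
    have "\<theta> / pi \<le> 1" using \<theta> by simp
    then have "e * (\<theta> / pi) \<le> e * 1" using e by (intro mult_left_mono) auto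
    then have u: "u \<le> 1" "1 - e \<le> u" using \<theta> e by (auto simp: u_def)
    have "tent e u = \<theta>" using tent_right[OF e u(2)] e by (simp add: u_def)
    \<comment> \<open>At \<open>\<theta> = 0\<close> the time \<open>u = 1\<close> wraps round to 0,
      and the tent vanishes at both.\<close>
    moreover have "tent e (frac u) = tent e u"
    proof (cases "u = 1")
      case True then show ?thesis using e by (simp add: tent_def)
    next
      case False then show ?thesis using u e by (simp add: frac_eq)
    qed
    ultimately show ?thesis by (simp add: u_def algebra_simps)
  qed
  show "?A \<union> ?B \<subseteq> range ?f"
    by (intro Un_least image_subsetI) (rule range_eqI, rule sym, erule left right)+
qed

text \<open>
  Component \<open>i\<close> descends from its base point \<open>b i\<close> inside the slab of heights around \<open>3 i\<close> and
  returns to the top during the last \<open>e\<close> of its period, where it meets no crossing.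
\<close>

lemma represents_unlink_layered:
  assumes D: "link_diagram D"
    and lay: "\<And>p q. p \<in> under D \<Longrightarrow> q \<in> params D \<Longrightarrow> p \<noteq> q \<Longrightarrow> point D p = point D q \<Longrightarrow>
      fst p < fst q \<or> fst p = fst q \<and> frac (snd q - b (fst p)) < frac (snd p - b (fst p))"
  shows "represents_unlink D"
proof -
  interpret crossing_game "crossing_params D" "partner D" by (rule crossing_game_diagram[OF D])
  \<comment> \<open>The times at which components meet crossings; \<open>0\<close> makes the maximum
    exist without crossings. Then \<open>e\<close> is half the time left after the latest of
    them.\<close>
  define M where "M = insert 0 ((\<lambda>p. frac (snd p - b (fst p))) ` crossing_params D)"
  have M: "finite M" "M \<noteq> {}" using finite_P by (auto simp: M_def)
  define e where "e = (1 - Max M) / 2"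
  have "Max M \<in> M" using Max_in M by blast
  then have "Max M < 1" by (auto simp: M_def frac_lt_1)
  moreover have "0 \<le> Max M" using Max_ge[OF M(1), of 0] by (simp add: M_def)
  ultimately have e: "0 < e" "e < 1" by (auto simp: e_def)
  have free_end: "frac (snd p - b (fst p)) \<le> 1 - e" if "p \<in> crossing_params D" for p
    using Max_ge[OF M(1), of "frac (snd p - b (fst p))"] that \<open>Max M < 1\<close> by (auto simp: M_def e_def field_simps)
  define h where "h i t = 3 * real i + cos (tent e (frac (t - b i)))" for i t
  define K where "K = (\<Union>i<ncomps D. range (\<lambda>t. (strand D i t, h i t)))"
  have "represents D K"
    unfolding represents_def
  proof (intro exI[of _ h] conjI allI impI ballI K_def)
    fix i
    have "continuous_on {0..1} (\<lambda>u. cos (tent e u))"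
      unfolding tent_def using e by (intro continuous_intros) auto
    then have "continuous_on UNIV (\<lambda>t. cos (tent e (frac t)))"
      by (rule continuous_on_frac) (use e in \<open>simp add: tent_def\<close>)
    then have "continuous_on UNIV (\<lambda>t. cos (tent e (frac (t - b i))))"
      by (rule continuous_on_compose2) (auto intro!: continuous_intros)
    then show "continuous_on UNIV (h i)"
      unfolding h_def by (rule continuous_on_add[OF continuous_on_const])
    show "h i (t + 1) = h i t" for t
      using frac_1_eq[of "t - b i"] by (simp add: h_def algebra_simps)
  next
    fix x p assume x: "x \<in> crossings D" and p: "p \<in> fibre D x \<inter> under D"
    have "h (fst p) (snd p) < h (fst q) (snd q)" if q: "q \<in> fibre D x - under D" for q
    proof -
      have pq: "p \<in> params D" "q \<in> params D" "p \<noteq> q" "point D p = point D q"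
        using p q by (auto simp: fibre_def)
      then have cr: "p \<in> crossing_params D" "q \<in> crossing_params D"
        using partner_unique(1)[OF D] by metis+
      from lay[OF _ pq(2-4)] p consider "fst p < fst q"
        | "fst p = fst q" "frac (snd q - b (fst q)) < frac (snd p - b (fst p))" by auto
      then show ?thesis
      proof cases
        case 1
        \<comment> \<open>Slabs of half-width 1 around centres at least 3 apart are
          disjoint.\<close>
        then have "real (fst p) + 1 \<le> real (fst q)" by linarith
        moreover have "cos (tent e (frac (snd p - b (fst p)))) \<le> 1"
          "- 1 \<le> cos (tent e (frac (snd q - b (fst q))))" by auto
        ultimately show ?thesis unfolding h_def by linarith
      next
        case 2
        let ?u = "frac (snd p - b (fst p))" and ?v = "frac (snd q - b (fst q))"
        \<comment> \<open>Both visits fall on the descending part, where the height decreases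
          strictly with time.\<close>
        have uv: "0 \<le> ?v" "?v < ?u" "?u \<le> 1 - e" "?v \<le> 1 - e"
          using 2(2) free_end[OF cr(1)] free_end[OF cr(2)] by auto
        have "?u / (1 - e) \<le> 1" using uv e by (simp add: field_simps)
        then have "pi * (?u / (1 - e)) \<le> pi" using mult_left_mono[of "?u / (1 - e)" 1 pi] by simp
        moreover have "pi * (?v / (1 - e)) < pi * (?u / (1 - e))"
          using uv e by (intro mult_strict_left_mono divide_strict_right_mono) auto
        ultimately have "cos (tent e ?u) < cos (tent e ?v)"
          using uv e by (simp add: tent_left cos_monotone_0_pi)
        then show ?thesis using 2 by (simp add: h_def)
      qed
    qed
    then show "case p of (i, s) \<Rightarrow> \<forall>(j, t)\<in>fibre D x - under D. h i s < h j t"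
      by (auto simp: case_prod_unfold)
  qed
  moreover have "unlink K"
  proof -
    have "\<exists>c d :: real \<Rightarrow> complex. continuous_on UNIV c \<and> continuous_on UNIV d \<and>
        (\<forall>\<theta>\<in>{0..pi}. exp (c (cos \<theta>)) * strand D i (b i + (1 - e) * \<theta> / pi) + d (cos \<theta>) = \<i> * sin \<theta> \<and>
          exp (c (cos \<theta>)) * strand D i (b i + 1 - e * \<theta> / pi) + d (cos \<theta>) = - (\<i> * sin \<theta>))"
      if i: "i < ncomps D" for i
    proof (rule ex_level_similarities)
      fix \<theta> :: real assume \<theta>: "0 < \<theta>" "\<theta> < pi"
      define u v where "u = (1 - e) * (\<theta> / pi)" and "v = 1 - e * (\<theta> / pi)"
      have "0 < \<theta> / pi" "\<theta> / pi < 1" using \<theta> by auto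
      then have "(1 - e) * (\<theta> / pi) < (1 - e) * 1" "e * (\<theta> / pi) < e * 1" "0 < (1 - e) * (\<theta> / pi)" "0 < e * (\<theta> / pi)"
        using e by (intro mult_strict_left_mono mult_pos_pos; simp)+
      then have uv: "0 < u" "u < 1 - e" "1 - e < v" "v < 1" by (auto simp: u_def v_def)
      let ?p = "(i, frac (b i + u))" and ?q = "(i, frac (b i + v))"
      have pos: "frac (frac (b i + u) - b i) = u" "frac (frac (b i + v) - b i) = v"
        using uv e by (auto intro!: frac_frac_add_diff)
      \<comment> \<open>A coincidence would be a crossing met at time \<open>v\<close>, beyond
        \<open>1 - e\<close>, which \<open>free_end\<close> excludes.\<close>
      show "strand D i (b i + (1 - e) * \<theta> / pi) \<noteq> strand D i (b i + 1 - e * \<theta> / pi)"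
      proof
        assume "strand D i (b i + (1 - e) * \<theta> / pi) = strand D i (b i + 1 - e * \<theta> / pi)"
        then have "strand D i (b i + u) = strand D i (b i + v)" by (simp add: u_def v_def algebra_simps)
        then have "point D ?q = point D ?p" using strand_frac[OF D i] by (simp add: point_def)
        moreover have "?p \<noteq> ?q" using pos uv by auto
        moreover have "?p \<in> params D" "?q \<in> params D" using i by (auto simp: params_def frac_lt_1)
        ultimately have "?q \<in> crossing_params D" using partner_unique(1)[OF D, of ?q ?p] by metis
        then show False using free_end[of ?q] pos uv by simp
      qed
    qed (use D i e in \<open>auto simp: link_diagram_def\<close>)
    then obtain c d :: "nat \<Rightarrow> real \<Rightarrow> complex" where
      cd_cont: "\<And>i. i < ncomps D \<Longrightarrow> continuous_on UNIV (c i)" "\<And>i. i < ncomps D \<Longrightarrow> continuous_on UNIV (d i)"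
      and cd: "\<And>i \<theta>. i < ncomps D \<Longrightarrow> \<theta> \<in> {0..pi} \<Longrightarrow>
          exp (c i (cos \<theta>)) * strand D i (b i + (1 - e) * \<theta> / pi) + d i (cos \<theta>) = \<i> * sin \<theta>"
        "\<And>i \<theta>. i < ncomps D \<Longrightarrow> \<theta> \<in> {0..pi} \<Longrightarrow>
          exp (c i (cos \<theta>)) * strand D i (b i + 1 - e * \<theta> / pi) + d i (cos \<theta>) = - (\<i> * sin \<theta>)"
      by metis
    obtain C where C: "continuous_on UNIV C" "\<forall>i<ncomps D. \<forall>y\<in>{-1..1}. C (3 * real i + y) = c i y"
      using glue_levels[of "ncomps D" c, OF cd_cont(1)] by auto
    obtain E where E: "continuous_on UNIV E" "\<forall>i<ncomps D. \<forall>y\<in>{-1..1}. E (3 * real i + y) = d i y"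
      using glue_levels[of "ncomps D" d, OF cd_cont(2)] by auto
    define \<phi> where "\<phi> = (\<lambda>(z, y). turn (pi / 2) (exp (C y) * z + E y, y))"
    have component: "\<phi> ` range (\<lambda>t. (strand D i t, h i t)) = sphere (of_real (3 * real i)) 1 \<times> {0}" if i: "i < ncomps D" for i
    proof -
      \<comment> \<open>The similarity makes both points of a level purely imaginary, so the quarter
        turn sends them to height zero.\<close>
      have "\<phi> (strand D i (b i + (1 - e) * \<theta> / pi), 3 * real i + cos \<theta>) = (Complex (3 * real i + cos \<theta>) (sin \<theta>), 0)"
        "\<phi> (strand D i (b i + 1 - e * \<theta> / pi), 3 * real i + cos \<theta>) = (Complex (3 * real i + cos \<theta>) (- sin \<theta>), 0)"
        if \<theta>: "\<theta> \<in> {0..pi}" for \<theta>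
        using C(2) E(2) i cd[OF i \<theta>]
        by (simp_all add: \<phi>_def turn_half_pi)
      moreover have "S \<times> {0 :: real} = (\<lambda>w. (w, 0)) ` S" for S :: "complex set" by auto
      ultimately show ?thesis
        unfolding h_def range_tent_curve[OF D i e] circle_param
        by (simp add: image_Un image_image cong: image_cong_simp)
    qed
    have "\<phi> ` K = (\<Union>i<ncomps D. \<phi> ` range (\<lambda>t. (strand D i t, h i t)))"
      unfolding K_def by (rule image_UN)
    also have "\<dots> = standard_unlink (ncomps D)"
      unfolding standard_unlink_def by (rule SUP_cong[OF refl component]) simp
    finally have eq: "\<phi> ` K = standard_unlink (ncomps D)" .
    have "ambient_isotopic K (\<phi> ` K)"
      unfolding \<phi>_def by (rule ambient_isotopic_level_similarity[OF C(1) E(1)])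
    then show ?thesis unfolding unlink_def eq by (rule exI)
  qed
  ultimately show ?thesis unfolding represents_unlink_def by blast
qed

theorem theorem1p2:
  fixes L :: diagram
  assumes "link_diagram L" and "connected (shadow L)"
  shows "\<exists>L'. arc_change_I\<^sup>*\<^sup>* L L' \<and> link_diagram L' \<and>
    ncomps L' = ncomps L \<and> strand L' = strand L \<and> represents_unlink L'"
proof -
  obtain U b where U: "arc_change_I\<^sup>*\<^sup>* L (L\<lparr>under := U\<rparr>)" "link_diagram (L\<lparr>under := U\<rparr>)"
    and lay: "\<And>p q. p \<in> U \<Longrightarrow> q \<in> params L \<Longrightarrow> p \<noteq> q \<Longrightarrow> point L p = point L q \<Longrightarrow>
       fst p < fst q \<or> fst p = fst q \<and> frac (snd q - b (fst p)) < frac (snd p - b (fst p))"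
    using ex_layered_diagram[OF assms(1)] by blast
  have "represents_unlink (L\<lparr>under := U\<rparr>)"
    using U(2) lay by (intro represents_unlink_layered[of _ b]) auto
  with U show ?thesis by (intro exI[of _ "L\<lparr>under := U\<rparr>"]) simp
qed

end
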